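(* Let $A$ and $B$ be $C^*$-algebras. Then $T_{\mathbb R}(A)$ is canonically isomorphic to the space of compact-open-continuous linear functionals on $T_{\mathbb R}(A)^*$: the canonical map $T_{\mathbb R}(A)\to (T_{\mathbb R}(A)^*,\mathrm{c.o.})^*$, $\tau\mapsto (f\mapsto f(\tau))$, is an isomorphism of ordered topological vector spaces. By taking dual maps, this induces a bijective correspondence between weak$^*$-continuous positive linear maps $T_{\mathbb R}(B) \to T_{\mathbb R}(A)$ and compact-open-continuous positive linear maps $T_{\mathbb R}(A)^* \to T_{\mathbb R}(B)^*$.
   Context: For a $C^*$-algebra $A$, $\mathrm{Ped}(A)$ denotes the Pedersen ideal of $A$ (the unique minimal norm-dense two-sided ideal), and $\mathrm{Ped}(A)_+=\mathrm{Ped}(A)\cap A_+$. $\mathrm{Ped}(A)$ is the directed union of the $C^*$-subalgebras $D$ of $A$ contained in $\mathrm{Ped}(A)$ and has the corresponding locally convex direct limit topology: a linear map from $\mathrm{Ped}(A)$ to a locally convex space is continuous iff its restriction to every such $D$ is norm-continuous. A linear functional $\tau\colon \mathrm{Ped}(A)\to\mathbb C$ is a trace if $\tau(xy)=\tau(yx)$ for all $x,y$, self-adjoint if $\tau(x^* )=\overline{\tau(x)}$, positive if $\tau(a)\ge 0$ for $a\in \mathrm{Ped}(A)_+$. $T_{\mathbb R}(A)$ is the real vector space of continuous self-adjoint traces on $\mathrm{Ped}(A)$ with the weak$^*$-topology (pointwise convergence on $\mathrm{Ped}(A)$), ordered by the cone $T_+(A)$ of positive traces. $T_{\mathbb R}(A)^*$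 is the space of weak$^*$-continuous linear functionals $T_{\mathbb R}(A)\to\mathbb R$, with the compact-open topology ($\mathrm{c.o.}$: uniform convergence on weak$^*$-compact subsets of $T_{\mathbb R}(A)$) and the positive cone $T_{\mathbb R}(A)^*_+=\{f : f(\tau)\ge 0 \text{ for all }\tau\in T_+(A)\}$. The space $(T_{\mathbb R}(A)^*,\mathrm{c.o.})^*$ of compact-open-continuous linear functionals $T_{\mathbb R}(A)^*\to\mathbb R$ carries the weak$^*$-topology (pointwise convergence on $T_{\mathbb R}(A)^*$) and the positive cone of functionals $g$ with $g(T_{\mathbb R}(A)^*_+)\subseteq[0,\infty)$. A linear map is positive if it maps positive cone into positive cone; an isomorphism of ordered topological vector spaces is a linear homeomorphism mapping the positive cone onto the positive cone. The dual of $\gamma\colon T_{\mathbb R}(B)\to T_{\mathbb R}(A)$ is $\gamma^*(f)=f\circ\gamma$; the dual of $\eta\colon T_{\mathbb R}(A)^*\to T_{\mathbb R}(B)^*$ is the map $\eta^*\colon T_{\mathbb R}(B)\to T_{\mathbb R}(A)$ obtained by dualising and using the canonical identifications above, i.e. $f(\eta^*(\tau))=\eta(f)(\tau)$ for $f\in T_{\mathbb R}(A)^*$, $\tau\in T_{\mathbb R}(B)$. *)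

theory Defs
  imports "HOL-Analysis.Analysis"
begin

section \<open>C*-algebras\<close>

text \<open>
  Complex C*-algebras, not necessarily unital; the zero algebra is allowed. The real scalar
  multiplication of the library classes is the restriction of the complex one.
\<close>

class cstar_algebra = real_normed_algebra + banach +
  fixes scaleC :: "complex \<Rightarrow> 'a \<Rightarrow> 'a"
    and star :: "'a \<Rightarrow> 'a"
  assumes scaleC_add_right: "scaleC c (x + y) = scaleC c x + scaleC c y"
    and scaleC_add_left: "scaleC (c + d) x = scaleC c x + scaleC d x"
    and scaleC_scaleC: "scaleC c (scaleC d x) = scaleC (c * d) x"
    and scaleC_of_real: "scaleC (complex_of_real r) x = scaleR r x"
    and mult_scaleC_left: "scaleC c x * y = scaleC c (x * y)"
    and mult_scaleC_right: "x * scaleC c y = scaleC c (x * y)"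
    and norm_scaleC: "norm (scaleC c x) = cmod c * norm x"
    and star_star: "star (star x) = x"
    and star_add: "star (x + y) = star x + star y"
    and star_scaleC: "star (scaleC c x) = scaleC (cnj c) (star x)"
    and star_mult: "star (x * y) = star y * star x"
    and norm_star_mult_self: "norm (star x * x) = (norm x)\<^sup>2"

definition csubspace :: "'a::cstar_algebra set \<Rightarrow> bool" where
  "csubspace S \<longleftrightarrow> 0 \<in> S \<and> (\<forall>x\<in>S. \<forall>y\<in>S. x + y \<in> S) \<and> (\<forall>c. \<forall>x\<in>S. scaleC c x \<in> S)"

definition two_sided_ideal :: "'a::cstar_algebra set \<Rightarrow> bool" where
  "two_sided_ideal I \<longleftrightarrow> csubspace I \<and> (\<forall>x\<in>I. \<forall>a. a * x \<in> I \<and> x * a \<in> I)"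

definition cstar_subalgebra :: "'a::cstar_algebra set \<Rightarrow> bool" where
  "cstar_subalgebra D \<longleftrightarrow>
     csubspace D \<and> closed D \<and> (\<forall>x\<in>D. \<forall>y\<in>D. x * y \<in> D) \<and> (\<forall>x\<in>D. star x \<in> D)"

definition cstar_pos :: "'a::cstar_algebra set" where
  "cstar_pos = {star b * b | b. True}"


section \<open>The Pedersen ideal and its direct limit topology\<close>

text \<open>
  The smallest dense two-sided ideal. By Pedersen's theorem the intersection is itself dense.
\<close>

definition ped :: "'a::cstar_algebra set" where
  "ped = \<Inter>{I. two_sided_ideal I \<and> closure I = UNIV}"

lemma ped_eq_least:
  assumes "two_sided_ideal I" "closure I = UNIV"
    and "\<And>J. two_sided_ideal J \<Longrightarrow> closure J = UNIV \<Longrightarrow> I \<subseteq> J"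
  shows "ped = I"
  using assms by (auto simp: ped_def)

lemma csubspace_ped: "csubspace ped"
  by (auto simp: ped_def csubspace_def two_sided_ideal_def)

lemma two_sided_ideal_ped: "two_sided_ideal ped"
  by (auto simp: ped_def csubspace_def two_sided_ideal_def)

text \<open>
  The absolutely convex neighbourhoods of 0 for the finest locally convex topology making all
  the inclusions of C*-subalgebras \<open>D \<subseteq> ped\<close> continuous.
\<close>

definition ped_nbhd0 :: "'a::cstar_algebra set \<Rightarrow> bool" where
  "ped_nbhd0 V \<longleftrightarrow> V \<subseteq> ped \<and> convex V \<and>
     (\<forall>c. \<forall>v\<in>V. cmod c \<le> 1 \<longrightarrow> scaleC c v \<in> V) \<and>
     (\<forall>D. cstar_subalgebra D \<and> D \<subseteq> ped \<longrightarrow> (\<exists>e>0. D \<inter> ball 0 e \<subseteq> V))"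

definition ped_topology :: "'a::cstar_algebra topology" where
  "ped_topology = topology (\<lambda>U. U \<subseteq> ped \<and> (\<forall>x\<in>U. \<exists>V. ped_nbhd0 V \<and> (\<lambda>v. x + v) ` V \<subseteq> U))"

lemma ped_nbhd0_Int:
  fixes V W :: "'a::cstar_algebra set"
  assumes "ped_nbhd0 V" "ped_nbhd0 W"
  shows "ped_nbhd0 (V \<inter> W)"
  unfolding ped_nbhd0_def
proof (intro conjI allI impI)
  fix D :: "'a set" assume D: "cstar_subalgebra D \<and> D \<subseteq> ped"
  obtain d where d: "d > 0" "D \<inter> ball 0 d \<subseteq> V"
    using D assms(1) unfolding ped_nbhd0_def by blast
  obtain e where e: "e > 0" "D \<inter> ball 0 e \<subseteq> W"
    using D assms(2) unfolding ped_nbhd0_def by blast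
  show "\<exists>e>0. D \<inter> ball 0 e \<subseteq> V \<inter> W"
    using d e by (intro exI[of _ "min d e"]) auto
qed (use assms in \<open>auto simp: ped_nbhd0_def intro: convex_Int\<close>)

lemma openin_ped_topology:
  "openin ped_topology U \<longleftrightarrow>
     U \<subseteq> ped \<and> (\<forall>x\<in>U. \<exists>V. ped_nbhd0 V \<and> (\<lambda>v. x + v) ` V \<subseteq> U)"
proof -
  have "istopology (\<lambda>U::'a set. U \<subseteq> ped \<and> (\<forall>x\<in>U. \<exists>V. ped_nbhd0 V \<and> (\<lambda>v. x + v) ` V \<subseteq> U))"
    unfolding istopology_def
  proof (intro conjI allI impI ballI)
    fix S T x :: "'a set" and y :: 'a
    assume S: "S \<subseteq> ped \<and> (\<forall>x\<in>S. \<exists>V. ped_nbhd0 V \<and> (\<lambda>v. x + v) ` V \<subseteq> S)"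
      and T: "T \<subseteq> ped \<and> (\<forall>x\<in>T. \<exists>V. ped_nbhd0 V \<and> (\<lambda>v. x + v) ` V \<subseteq> T)"
      and y: "y \<in> S \<inter> T"
    obtain V where V: "ped_nbhd0 V" "(\<lambda>v. y + v) ` V \<subseteq> S" using S y by blast
    obtain W where W: "ped_nbhd0 W" "(\<lambda>v. y + v) ` W \<subseteq> T" using T y by blast
    show "\<exists>V. ped_nbhd0 V \<and> (\<lambda>v. y + v) ` V \<subseteq> S \<inter> T"
      using V W by (intro exI[of _ "V \<inter> W"]) (auto intro: ped_nbhd0_Int)
  next
    fix \<K> :: "'a set set" and y :: 'a
    assume K: "\<forall>K\<in>\<K>. K \<subseteq> ped \<and> (\<forall>x\<in>K. \<exists>V. ped_nbhd0 V \<and> (\<lambda>v. x + v) ` V \<subseteq> K)"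
      and y: "y \<in> \<Union>\<K>"
    then obtain S where S: "S \<in> \<K>" "y \<in> S" by blast
    then obtain V where "ped_nbhd0 V" "(\<lambda>v. y + v) ` V \<subseteq> S" using K by blast
    then show "\<exists>V. ped_nbhd0 V \<and> (\<lambda>v. y + v) ` V \<subseteq> \<Union>\<K>" using S by blast
  qed auto
  then show ?thesis
    by (simp add: ped_topology_def topology_inverse')
qed

lemma topspace_ped_topology: "topspace ped_topology = ped"
proof -
  have "ped_nbhd0 (ped :: 'a set)"
    unfolding ped_nbhd0_def
  proof (intro conjI allI impI)
    show "convex (ped :: 'a set)"
      using csubspace_ped[where 'a='a] unfolding convex_def csubspace_def
      by (simp flip: scaleC_of_real)
    show "\<exists>e>0. D \<inter> ball 0 e \<subseteq> ped" if "cstar_subalgebra D \<and> D \<subseteq> ped" for D :: "'a set"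
      using that by (intro exI[of _ 1]) auto
  qed (use csubspace_ped[where 'a='a] in \<open>auto simp: csubspace_def\<close>)
  moreover have "(\<lambda>v. x + v) ` ped \<subseteq> ped" if "x \<in> ped" for x :: 'a
    using that csubspace_ped[where 'a='a] by (auto simp: csubspace_def)
  ultimately have "openin ped_topology (ped :: 'a set)"
    unfolding openin_ped_topology by blast
  then have "ped \<subseteq> topspace (ped_topology :: 'a topology)"
    by (rule openin_subset)
  moreover have "topspace (ped_topology :: 'a topology) \<subseteq> ped"
    using openin_topspace[of "ped_topology :: 'a topology"] unfolding openin_ped_topology by blast
  ultimately show ?thesis by blast
qed

definition ped_linear :: "('a::cstar_algebra \<Rightarrow> complex) \<Rightarrow> bool" where
  "ped_linear t \<longleftrightarrow>
     (\<forall>x\<in>ped. \<forall>y\<in>ped. t (x + y) = t x + t y) \<and> (\<forall>c. \<forall>x\<in>ped. t (scaleC c x) = c * t x)"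

lemma continuous_map_ped_topology_iff:
  assumes "ped_linear t"
  shows "continuous_map ped_topology euclidean t \<longleftrightarrow>
    (\<forall>D. cstar_subalgebra D \<and> D \<subseteq> ped \<longrightarrow> continuous_on D t)"
proof (intro iffI allI impI)
  fix D :: "'a set"
  assume t: "continuous_map ped_topology euclidean t"
    and D: "cstar_subalgebra D \<and> D \<subseteq> ped"
  have minus: "y - x \<in> D" if "x \<in> D" "y \<in> D" for x y
  proof -
    have "y + scaleC (complex_of_real (-1)) x \<in> D"
      using that D unfolding cstar_subalgebra_def csubspace_def by blast
    then show ?thesis unfolding scaleC_of_real by simp
  qed
  have "continuous_map (top_of_set D) ped_topology (\<lambda>x. x)"
    unfolding continuous_map
  proof (intro conjI allI impI)
    show "(\<lambda>x. x) ` topspace (top_of_set D) \<subseteq> topspace ped_topology"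
      using D by (simp add: topspace_ped_topology)
    fix U :: "'a set" assume U: "openin ped_topology U"
    have "openin (top_of_set D) {x \<in> D. x \<in> U}"
      unfolding openin_contains_ball
    proof (intro conjI ballI)
      fix x assume x: "x \<in> {x \<in> D. x \<in> U}"
      then obtain V where V: "ped_nbhd0 V" "(\<lambda>v. x + v) ` V \<subseteq> U"
        using U unfolding openin_ped_topology by blast
      then obtain e where e: "e > 0" "D \<inter> ball 0 e \<subseteq> V"
        using D unfolding ped_nbhd0_def by blast
      have "y \<in> U" if y: "y \<in> D" "dist x y < e" for y
      proof -
        have "y - x \<in> D \<inter> ball 0 e"
          using minus[of x y] x y by (simp add: dist_norm norm_minus_commute)
        then have "x + (y - x) \<in> U" using e V by blast
        then show ?thesis by simp
      qed
      then show "\<exists>e>0. ball x e \<inter> D \<subseteq> {x \<in> D. x \<in> U}"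
        using e(1) by (intro exI[of _ e]) auto
    qed auto
    then show "openin (top_of_set D) {x \<in> topspace (top_of_set D). x \<in> U}" by simp
  qed
  from continuous_map_compose[OF this t] show "continuous_on D t"
    by (simp add: o_def)
next
  assume t: "\<forall>D. cstar_subalgebra D \<and> D \<subseteq> ped \<longrightarrow> continuous_on D t"
  have add: "t (x + y) = t x + t y" if "x \<in> ped" "y \<in> ped" for x y
    using assms that by (auto simp: ped_linear_def)
  have scale: "t (scaleC c x) = c * t x" if "x \<in> ped" for c x
    using assms that by (auto simp: ped_linear_def)
  have scaleR: "t (r *\<^sub>R x) = r * t x" "r *\<^sub>R x \<in> ped" if "x \<in> ped" for r x
    using scale[OF that, of "complex_of_real r"] csubspace_ped[where 'a='a] that
    unfolding csubspace_def scaleC_of_real by (auto simp flip: scaleC_of_real)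
  have t0: "t 0 = 0"
    using add[of 0 0] csubspace_ped[where 'a='a] by (auto simp: csubspace_def)
  have nbhd: "ped_nbhd0 {v \<in> ped. cmod (t v) < e}" if e: "e > 0" for e
    unfolding ped_nbhd0_def
  proof (intro conjI allI impI ballI)
    have lin: "u *\<^sub>R x + v *\<^sub>R y \<in> ped" "t (u *\<^sub>R x + v *\<^sub>R y) = u *\<^sub>R t x + v *\<^sub>R t y"
      if "x \<in> ped" "y \<in> ped" for x y u v
      using that scaleR csubspace_ped[where 'a='a] add
      by (auto simp: csubspace_def scaleR_conv_of_real)
    have "convex (ball (0::complex) e)" by simp
    then show "convex {v \<in> ped. cmod (t v) < e}"
      using lin unfolding convex_def by (auto simp del: convex_ball)
  next
    fix c v assume v: "v \<in> {v \<in> ped. cmod (t v) < e}" and c: "cmod c \<le> 1"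
    have "cmod c * cmod (t v) \<le> cmod (t v)" using c by (simp add: mult_left_le_one_le)
    then show "scaleC c v \<in> {v \<in> ped. cmod (t v) < e}"
      using v scale csubspace_ped[where 'a='a] by (auto simp: csubspace_def norm_mult)
  next
    fix D :: "'a set" assume D: "cstar_subalgebra D \<and> D \<subseteq> ped"
    then have "continuous_on D t" "0 \<in> D"
      using t by (auto simp: cstar_subalgebra_def csubspace_def)
    then obtain d where "d > 0" "\<And>x. x \<in> D \<Longrightarrow> dist x 0 < d \<Longrightarrow> dist (t x) (t 0) < e"
      using e unfolding continuous_on_iff by metis
    then show "\<exists>d>0. D \<inter> ball 0 d \<subseteq> {v \<in> ped. cmod (t v) < e}"
      using D t0 by (intro exI[of _ d]) auto
  qed auto
  show "continuous_map ped_topology euclidean t"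
    unfolding continuous_map
  proof (intro conjI allI impI)
    fix W :: "complex set" assume W: "openin euclidean W"
    show "openin ped_topology {x \<in> topspace ped_topology. t x \<in> W}"
      unfolding openin_ped_topology topspace_ped_topology
    proof (intro conjI ballI)
      fix x assume x: "x \<in> {x \<in> ped. t x \<in> W}"
      then obtain e where e: "e > 0" "ball (t x) e \<subseteq> W"
        using W by (auto simp: open_contains_ball)
      have "x + v \<in> ped \<and> t (x + v) \<in> W" if v: "v \<in> ped" "cmod (t v) < e" for v
      proof -
        have "t (x + v) \<in> ball (t x) e" using add x v by (simp add: dist_norm)
        then show ?thesis
          using e x v csubspace_ped[where 'a='a] by (auto simp: csubspace_def)
      qed
      then show "\<exists>V. ped_nbhd0 V \<and> (\<lambda>v. x + v) ` V \<subseteq> {x \<in> ped. t x \<in> W}"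
        using nbhd[OF e(1)] by (intro exI[of _ "{v \<in> ped. cmod (t v) < e}"]) auto
    qed auto
  qed auto
qed


section \<open>The space of continuous self-adjoint traces\<close>

text \<open>
  A functional on \<open>ped\<close> is represented by its extension by 0, so that equality of functions
  is equality of functionals.
\<close>

typedef (overloaded) 'a trace_space =
  "{t :: 'a::cstar_algebra \<Rightarrow> complex.
      (\<forall>x. x \<notin> ped \<longrightarrow> t x = 0) \<and>
      ped_linear t \<and>
      continuous_map ped_topology euclidean t \<and>
      (\<forall>x\<in>ped. \<forall>y\<in>ped. t (x * y) = t (y * x)) \<and>
      (\<forall>x\<in>ped. t (star x) = cnj (t x))}"
  morphisms trace_app Abs_trace
  by (rule exI[of _ "\<lambda>_. 0"]) (auto simp: ped_linear_def)

setup_lifting type_definition_trace_space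

instantiation trace_space :: (cstar_algebra) real_vector
begin

lift_definition zero_trace_space :: "'a trace_space" is "\<lambda>_. 0"
  by (auto simp: ped_linear_def)

lift_definition plus_trace_space :: "'a trace_space \<Rightarrow> 'a trace_space \<Rightarrow> 'a trace_space"
  is "\<lambda>s t x. s x + t x"
  by (auto simp: ped_linear_def algebra_simps intro!: continuous_map_add)

lift_definition minus_trace_space :: "'a trace_space \<Rightarrow> 'a trace_space \<Rightarrow> 'a trace_space"
  is "\<lambda>s t x. s x - t x"
  by (auto simp: ped_linear_def algebra_simps intro!: continuous_map_diff)

lift_definition uminus_trace_space :: "'a trace_space \<Rightarrow> 'a trace_space"
  is "\<lambda>t x. - t x"
  by (auto simp: ped_linear_def algebra_simps intro!: continuous_map_minus)

lift_definition scaleR_trace_space :: "real \<Rightarrow> 'a trace_space \<Rightarrow> 'a trace_space"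
  is "\<lambda>r t x. r *\<^sub>R t x"
  by (auto simp: ped_linear_def algebra_simps continuous_map_atin intro!: tendsto_scaleR)

instance
  by standard (transfer; auto simp: algebra_simps fun_eq_iff)+

end

text \<open>Weak*-topology: induced by the product topology of the function type.\<close>

instantiation trace_space :: (cstar_algebra) topological_space
begin

definition open_trace_space :: "'a trace_space set \<Rightarrow> bool" where
  "open U \<longleftrightarrow> (\<exists>W. open W \<and> U = trace_app -` W)"

instance
proof
  show "open (UNIV :: 'a trace_space set)"
    unfolding open_trace_space_def by (rule exI[of _ UNIV]) auto
next
  fix S T :: "'a trace_space set"
  assume "open S" "open T"
  then obtain V W where "open V" "S = trace_app -` V" "open W" "T = trace_app -` W"
    unfolding open_trace_space_def by blast
  then show "open (S \<inter> T)"
    unfolding open_trace_space_def by (intro exI[of _ "V \<inter> W"]) auto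
next
  fix \<K> :: "'a trace_space set set"
  assume "\<forall>S\<in>\<K>. open S"
  then obtain W where W: "\<And>S. S \<in> \<K> \<Longrightarrow> open (W S) \<and> S = trace_app -` W S"
    unfolding open_trace_space_def by metis
  then have "\<Union>\<K> = trace_app -` (\<Union>S\<in>\<K>. W S)" by blast
  moreover have "open (\<Union>S\<in>\<K>. W S)" using W by blast
  ultimately show "open (\<Union>\<K>)"
    unfolding open_trace_space_def by blast
qed

end

definition pos_traces :: "'a::cstar_algebra trace_space set" where
  "pos_traces = {t. \<forall>a \<in> ped \<inter> cstar_pos. trace_app t a \<in> \<real> \<and> Re (trace_app t a) \<ge> 0}"


section \<open>Dual spaces\<close>

text \<open>
  The continuous dual of \<open>'v\<close> occurs with two topologies: the compact-open one
  (\<open>'v co_dual\<close>) and the weak* one (\<open>'v weak_dual\<close>).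
\<close>

definition cont_functionals :: "('v::{real_vector,topological_space} \<Rightarrow> real) set" where
  "cont_functionals = {f. linear f \<and> continuous_on UNIV f}"

lemma cont_functionals_zero: "(\<lambda>_. 0) \<in> cont_functionals"
  by (auto simp: cont_functionals_def intro!: linearI)

lemma cont_functionals_add:
  "f \<in> cont_functionals \<Longrightarrow> g \<in> cont_functionals \<Longrightarrow> (\<lambda>x. f x + g x) \<in> cont_functionals"
  unfolding cont_functionals_def
  by (auto intro!: linearI continuous_on_add simp: linear_add linear_scale algebra_simps)

lemma cont_functionals_diff:
  "f \<in> cont_functionals \<Longrightarrow> g \<in> cont_functionals \<Longrightarrow> (\<lambda>x. f x - g x) \<in> cont_functionals"
  unfolding cont_functionals_def
  by (auto intro!: linearI continuous_on_diff simp: linear_add linear_scale algebra_simps)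

lemma cont_functionals_minus:
  "f \<in> cont_functionals \<Longrightarrow> (\<lambda>x. - f x) \<in> cont_functionals"
  unfolding cont_functionals_def
  by (auto intro!: linearI continuous_on_minus simp: linear_add linear_scale algebra_simps)

lemma cont_functionals_scaleR:
  "f \<in> cont_functionals \<Longrightarrow> (\<lambda>x. r *\<^sub>R f x) \<in> cont_functionals"
  unfolding cont_functionals_def
  by (auto intro!: linearI continuous_on_mult_left simp: linear_add linear_scale algebra_simps)

typedef (overloaded) 'v co_dual =
    "cont_functionals :: ('v::{real_vector,topological_space} \<Rightarrow> real) set"
  morphisms co_app Abs_co_dual
  using cont_functionals_zero by blast

typedef (overloaded) 'v weak_dual =
    "cont_functionals :: ('v::{real_vector,topological_space} \<Rightarrow> real) set"
  morphisms weak_app Abs_weak_dual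
  using cont_functionals_zero by blast

setup_lifting type_definition_co_dual
setup_lifting type_definition_weak_dual

instantiation co_dual :: ("{real_vector,topological_space}") real_vector
begin

lift_definition zero_co_dual :: "'a co_dual" is "\<lambda>_. 0"
  by (rule cont_functionals_zero)
lift_definition plus_co_dual :: "'a co_dual \<Rightarrow> 'a co_dual \<Rightarrow> 'a co_dual" is "\<lambda>f g x. f x + g x"
  by (rule cont_functionals_add)
lift_definition minus_co_dual :: "'a co_dual \<Rightarrow> 'a co_dual \<Rightarrow> 'a co_dual" is "\<lambda>f g x. f x - g x"
  by (rule cont_functionals_diff)
lift_definition uminus_co_dual :: "'a co_dual \<Rightarrow> 'a co_dual" is "\<lambda>f x. - f x"
  by (rule cont_functionals_minus)
lift_definition scaleR_co_dual :: "real \<Rightarrow> 'a co_dual \<Rightarrow> 'a co_dual" is "\<lambda>r f x. r *\<^sub>R f x"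
  by (rule cont_functionals_scaleR)

instance
  by standard (transfer; auto simp: algebra_simps fun_eq_iff)+

end

instantiation weak_dual :: ("{real_vector,topological_space}") real_vector
begin

lift_definition zero_weak_dual :: "'a weak_dual" is "\<lambda>_. 0"
  by (rule cont_functionals_zero)
lift_definition plus_weak_dual :: "'a weak_dual \<Rightarrow> 'a weak_dual \<Rightarrow> 'a weak_dual"
  is "\<lambda>f g x. f x + g x"
  by (rule cont_functionals_add)
lift_definition minus_weak_dual :: "'a weak_dual \<Rightarrow> 'a weak_dual \<Rightarrow> 'a weak_dual"
  is "\<lambda>f g x. f x - g x"
  by (rule cont_functionals_diff)
lift_definition uminus_weak_dual :: "'a weak_dual \<Rightarrow> 'a weak_dual" is "\<lambda>f x. - f x"
  by (rule cont_functionals_minus)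
lift_definition scaleR_weak_dual :: "real \<Rightarrow> 'a weak_dual \<Rightarrow> 'a weak_dual"
  is "\<lambda>r f x. r *\<^sub>R f x"
  by (rule cont_functionals_scaleR)

instance
  by standard (transfer; auto simp: algebra_simps fun_eq_iff)+

end

instantiation co_dual :: ("{real_vector,topological_space}") topological_space
begin

definition open_co_dual :: "'a co_dual set \<Rightarrow> bool" where
  "open U \<longleftrightarrow> (\<forall>f\<in>U. \<exists>K e. compact K \<and> e > 0 \<and>
     {g. \<forall>x\<in>K. \<bar>co_app g x - co_app f x\<bar> < e} \<subseteq> U)"

instance
proof
  show "open (UNIV :: 'a co_dual set)"
    unfolding open_co_dual_def by (intro ballI exI[of _ "{}"] exI[of _ "1::real"]) auto
next
  fix S T :: "'a co_dual set"
  assume S: "open S" and T: "open T"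
  show "open (S \<inter> T)"
    unfolding open_co_dual_def
  proof
    fix f assume f: "f \<in> S \<inter> T"
    obtain K d where K: "compact K" "d > 0" "{g. \<forall>x\<in>K. \<bar>co_app g x - co_app f x\<bar> < d} \<subseteq> S"
      using bspec[OF S[unfolded open_co_dual_def], of f] f by (elim IntE) blast
    obtain L e where L: "compact L" "e > 0" "{g. \<forall>x\<in>L. \<bar>co_app g x - co_app f x\<bar> < e} \<subseteq> T"
      using bspec[OF T[unfolded open_co_dual_def], of f] f by (elim IntE) blast
    show "\<exists>K e. compact K \<and> e > 0 \<and> {g. \<forall>x\<in>K. \<bar>co_app g x - co_app f x\<bar> < e} \<subseteq> S \<inter> T"
    proof (intro exI conjI)
      show "compact (K \<union> L)" using K(1) L(1) by (rule compact_Un)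
      show "min d e > 0" using K(2) L(2) by simp
      show "{g. \<forall>x\<in>K \<union> L. \<bar>co_app g x - co_app f x\<bar> < min d e} \<subseteq> S \<inter> T"
        using K(3) L(3) by auto
    qed
  qed
next
  fix \<K> :: "'a co_dual set set"
  assume "\<forall>S\<in>\<K>. open S"
  then show "open (\<Union>\<K>)"
    unfolding open_co_dual_def by (meson Sup_upper UnionE subset_trans)
qed

end

instantiation weak_dual :: ("{real_vector,topological_space}") topological_space
begin

definition open_weak_dual :: "'a weak_dual set \<Rightarrow> bool" where
  "open U \<longleftrightarrow> (\<exists>W. open W \<and> U = weak_app -` W)"

instance
proof
  show "open (UNIV :: 'a weak_dual set)"
    unfolding open_weak_dual_def by (rule exI[of _ UNIV]) auto
next
  fix S T :: "'a weak_dual set"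
  assume "open S" "open T"
  then obtain V W where "open V" "S = weak_app -` V" "open W" "T = weak_app -` W"
    unfolding open_weak_dual_def by blast
  then show "open (S \<inter> T)"
    unfolding open_weak_dual_def by (intro exI[of _ "V \<inter> W"]) auto
next
  fix \<K> :: "'a weak_dual set set"
  assume "\<forall>S\<in>\<K>. open S"
  then obtain W where W: "\<And>S. S \<in> \<K> \<Longrightarrow> open (W S) \<and> S = weak_app -` W S"
    unfolding open_weak_dual_def by metis
  then have "\<Union>\<K> = weak_app -` (\<Union>S\<in>\<K>. W S)" by blast
  moreover have "open (\<Union>S\<in>\<K>. W S)" using W by blast
  ultimately show "open (\<Union>\<K>)"
    unfolding open_weak_dual_def by blast
qed

end

definition co_dual_cone :: "'v::{real_vector,topological_space} set \<Rightarrow> 'v co_dual set" where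
  "co_dual_cone C = {f. \<forall>x\<in>C. co_app f x \<ge> 0}"

definition weak_dual_cone :: "'v::{real_vector,topological_space} set \<Rightarrow> 'v weak_dual set" where
  "weak_dual_cone C = {f. \<forall>x\<in>C. weak_app f x \<ge> 0}"


section \<open>Positive maps, dual maps and the canonical map\<close>

definition cont_pos_linear ::
  "'v::{real_vector,topological_space} set \<Rightarrow> 'w::{real_vector,topological_space} set
    \<Rightarrow> ('v \<Rightarrow> 'w) set" where
  "cont_pos_linear C D = {h. linear h \<and> continuous_on UNIV h \<and> h ` C \<subseteq> D}"

definition ordered_tvs_iso ::
  "'v::{real_vector,topological_space} set \<Rightarrow> 'w::{real_vector,topological_space} set
    \<Rightarrow> ('v \<Rightarrow> 'w) \<Rightarrow> bool" where
  "ordered_tvs_iso C D h \<longleftrightarrow>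
     linear h \<and> (\<exists>k. homeomorphism UNIV UNIV h k) \<and> h ` C = D"

definition eval_map :: "'v::{real_vector,topological_space} \<Rightarrow> 'v co_dual weak_dual" where
  "eval_map x = Abs_weak_dual (\<lambda>f. co_app f x)"

text \<open>The dual maps are meaningful for continuous linear arguments only; see the lemmas below.\<close>

definition co_dual_map ::
  "('w::{real_vector,topological_space} \<Rightarrow> 'v::{real_vector,topological_space})
    \<Rightarrow> 'v co_dual \<Rightarrow> 'w co_dual" where
  "co_dual_map h f = Abs_co_dual (co_app f \<circ> h)"

definition weak_dual_map ::
  "('w::{real_vector,topological_space} \<Rightarrow> 'v::{real_vector,topological_space})
    \<Rightarrow> 'v weak_dual \<Rightarrow> 'w weak_dual" where
  "weak_dual_map h g = Abs_weak_dual (weak_app g \<circ> h)"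

text \<open>The dual of a map between compact-open duals, read on the original spaces via \<open>eval_map\<close>.\<close>

definition predual_map ::
  "('v::{real_vector,topological_space} co_dual \<Rightarrow> 'w::{real_vector,topological_space} co_dual)
    \<Rightarrow> 'w \<Rightarrow> 'v" where
  "predual_map h = inv eval_map \<circ> weak_dual_map h \<circ> eval_map"

lemma weak_app_eval_map: "weak_app (eval_map x) f = co_app f x"
proof -
  have "continuous_on UNIV (\<lambda>f::'a co_dual. co_app f x)"
    unfolding continuous_on_open_vimage[OF open_UNIV]
  proof (intro allI impI)
    fix B :: "real set" assume B: "open B"
    show "open ((\<lambda>f. co_app f x) -` B \<inter> UNIV)"
      unfolding open_co_dual_def
    proof
      fix f assume "f \<in> (\<lambda>f. co_app f x) -` B \<inter> UNIV"
      then obtain e where e: "e > 0" "ball (co_app f x) e \<subseteq> B"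
        using B by (auto simp: open_contains_ball)
      then show "\<exists>K e. compact K \<and> 0 < e \<and>
          {g. \<forall>y\<in>K. \<bar>co_app g y - co_app f y\<bar> < e} \<subseteq> (\<lambda>f. co_app f x) -` B \<inter> UNIV"
        by (intro exI[of _ "{x}"] exI[of _ e])
          (auto simp: subset_iff dist_real_def abs_minus_commute)
    qed
  qed
  moreover have "linear (\<lambda>f::'a co_dual. co_app f x)"
    by (rule linearI) (transfer; simp)+
  ultimately have "(\<lambda>f::'a co_dual. co_app f x) \<in> cont_functionals"
    by (simp add: cont_functionals_def)
  then show ?thesis
    by (simp add: eval_map_def Abs_weak_dual_inverse)
qed

lemma cont_functionals_comp:
  "linear h \<Longrightarrow> continuous_on UNIV h \<Longrightarrow> f \<in> cont_functionals \<Longrightarrow> f \<circ> h \<in> cont_functionals"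
  unfolding cont_functionals_def
  using continuous_on_compose[of UNIV h f] continuous_on_subset[of UNIV f "range h"]
  by (simp add: linear_compose)

lemma co_app_co_dual_map:
  assumes "linear h" "continuous_on UNIV h"
  shows "co_app (co_dual_map h f) x = co_app f (h x)"
  using cont_functionals_comp[OF assms co_app[of f]]
  by (simp add: co_dual_map_def Abs_co_dual_inverse)

lemma weak_app_weak_dual_map:
  assumes "linear h" "continuous_on UNIV h"
  shows "weak_app (weak_dual_map h g) x = weak_app g (h x)"
  using cont_functionals_comp[OF assms weak_app[of g]]
  by (simp add: weak_dual_map_def Abs_weak_dual_inverse)

end

theory Submission
  imports Defs
begin

text \<open>
  A compact-open continuous functional \<open>g\<close> on the dual of the trace space is controlled by the
  supremum over a compact set of traces. Evaluating \<open>g\<close> at the point evaluations gives a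
  self-adjoint tracial functional \<open>\<tau>\<close> on the Pedersen ideal; by Banach-Steinhaus it is bounded on
  each C*-subalgebra \<open>D\<close>, hence continuous. Every weak*-continuous functional on the trace space is
  a finite combination of point evaluations, so \<open>g\<close> is evaluation at \<open>\<tau>\<close>. The statements about
  dual maps hold for any two spaces for which the canonical map is such an isomorphism.
\<close>

section \<open>Two facts from functional analysis\<close>

text \<open>Banach-Steinhaus by Baire category in the complete space \<open>S\<close>: the closed
  sets \<open>E n\<close> cover it, so one of them contains a relative ball. Linearity is asked on
  \<open>S\<close> only, because traces are linear on \<open>ped\<close> and extended by 0.\<close>

lemma uniform_boundedness_closed_subspace:
  fixes T :: "'i \<Rightarrow> 'v::banach \<Rightarrow> 'w::real_normed_vector"
  assumes "closed S" "subspace S"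
    and cont: "\<And>i. i \<in> K \<Longrightarrow> continuous_on S (T i)"
    and diff: "\<And>i x y. i \<in> K \<Longrightarrow> x \<in> S \<Longrightarrow> y \<in> S \<Longrightarrow> T i (x - y) = T i x - T i y"
    and scale: "\<And>i r x. i \<in> K \<Longrightarrow> x \<in> S \<Longrightarrow> T i (r *\<^sub>R x) = r *\<^sub>R T i x"
    and bdd: "\<And>x. x \<in> S \<Longrightarrow> \<exists>B. \<forall>i\<in>K. norm (T i x) \<le> B"
  obtains M where "M > 0" "\<And>i x. i \<in> K \<Longrightarrow> x \<in> S \<Longrightarrow> norm (T i x) \<le> M * norm x"
proof -
  define E where "E n = {x \<in> S. \<forall>i\<in>K. norm (T i x) \<le> real n}" for n
  have closedin_E: "closedin (top_of_set S) (E n)" for n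
  proof -
    have "closedin (top_of_set S) (S \<inter> T i -` cball 0 (real n))" if "i \<in> K" for i
      using cont[OF that] by (intro continuous_closedin_preimage) auto
    then have "K \<noteq> {} \<Longrightarrow> closedin (top_of_set S) (\<Inter>i\<in>K. S \<inter> T i -` cball 0 (real n))"
      by (intro closedin_Inter) auto
    \<comment> \<open>For empty \<open>K\<close> the intersection would be the whole type instead of
      \<open>S\<close>.\<close>
    moreover have "E n = (if K = {} then S else \<Inter>i\<in>K. S \<inter> T i -` cball 0 (real n))"
      by (auto simp: E_def)
    ultimately show ?thesis by simp
  qed
  have "\<exists>n. x \<in> E n" if x: "x \<in> S" for x
  proof -
    obtain B where "\<forall>i\<in>K. norm (T i x) \<le> B" using bdd[OF x] by blast
    moreover obtain n where "B \<le> real n" using real_arch_simple by blast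
    ultimately show ?thesis using x by (auto simp: E_def intro!: exI[of _ n])
  qed
  then have cover: "\<Union>(range E) = S" by (auto simp: E_def)
  have "completely_metrizable_space (top_of_set S)"
    using assms(1) closed_closedin completely_metrizable_space_closedin
      completely_metrizable_space_euclidean by blast
  moreover have "top_of_set S interior_of S \<noteq> {}"
    using interior_of_topspace[of "top_of_set S"] subspace_0[OF assms(2)] by auto
  ultimately obtain n where "top_of_set S interior_of E n \<noteq> {}"
    using Baire_category_alt[of "top_of_set S" "range E"] closedin_E cover by auto
  then obtain x0 U where U: "openin (top_of_set S) U" "x0 \<in> U" "U \<subseteq> E n"
    by (auto simp: interior_of_def)
  then obtain e where e: "e > 0" "ball x0 e \<inter> S \<subseteq> U" and x0: "x0 \<in> S"
    unfolding openin_contains_ball by blast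
  show thesis
  proof
    \<comment> \<open>\<open>n\<close> may be 0; the summand 1 keeps the constant positive.\<close>
    show "4 * real n / e + 1 > 0" using e(1) by (simp add: add_nonneg_pos)
    fix i x assume i: "i \<in> K" and x: "x \<in> S"
    show "norm (T i x) \<le> (4 * real n / e + 1) * norm x"
    proof (cases "x = 0")
      case True
      then show ?thesis using scale[OF i x, of 0] by simp
    next
      case False
      \<comment> \<open>This scale puts \<open>x0 + r *\<^sub>R x\<close> at distance
        \<open>e / 2\<close> from \<open>x0\<close>, so \<open>T i (r *\<^sub>R x)\<close> is a
        difference of two values bounded by \<open>n\<close>.\<close>
      define r where "r = e / (2 * norm x)"
      have r: "r > 0" using False e(1) by (simp add: r_def)
      define y where "y = x0 + r *\<^sub>R x"
      have yS: "y \<in> S" using assms(2) x0 x by (auto simp: y_def subspace_add subspace_scale)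
      have "dist x0 y < e" using False e(1) r by (simp add: y_def dist_norm r_def)
      then have "y \<in> E n" using e(2) U(3) yS by auto
      then have "norm (T i y) \<le> n" "norm (T i x0) \<le> n"
        using U(2,3) i by (auto simp: E_def)
      then have "norm (T i y - T i x0) \<le> 2 * n"
        using norm_triangle_ineq4[of "T i y" "T i x0"] by linarith
      also have "T i y - T i x0 = r *\<^sub>R T i x"
        using diff[OF i yS x0] scale[OF i x] by (simp add: y_def)
      finally have "r * norm (T i x) \<le> 2 * n" using r by simp
      then have "norm (T i x) \<le> 2 * n / r" using r by (simp add: field_simps)
      also have "\<dots> = 4 * n / e * norm x" using False e(1) by (simp add: r_def field_simps)
      also have "\<dots> \<le> (4 * real n / e + 1) * norm x" by (simp add: algebra_simps)
      finally show ?thesis .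
    qed
  qed
qed

text \<open>Induction on \<open>I\<close>. Either \<open>\<phi> j\<close> vanishes on the common
  kernel of the others and gets coefficient 0, or a suitable multiple of it can be subtracted from
  \<open>f\<close> to reach the induction hypothesis.\<close>

lemma linear_functional_combination:
  fixes f :: "'v::real_vector \<Rightarrow> real"
  assumes "finite I" "\<And>i. i \<in> I \<Longrightarrow> linear (\<phi> i)" "linear f"
    and "\<And>x. (\<And>i. i \<in> I \<Longrightarrow> \<phi> i x = 0) \<Longrightarrow> f x = 0"
  shows "\<exists>c. \<forall>x. f x = (\<Sum>i\<in>I. c i * \<phi> i x)"
  using assms
proof (induction I arbitrary: f rule: finite_induct)
  case empty
  then show ?case by auto
next
  case (insert j I)
  have lin: "linear (\<phi> i)" if "i = j \<or> i \<in> I" for i using insert.prems(1) that by auto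
  show ?case
  proof (cases "\<exists>z. (\<forall>i\<in>I. \<phi> i z = 0) \<and> \<phi> j z \<noteq> 0")
    case False
    have "\<exists>c. \<forall>x. f x = (\<Sum>i\<in>I. c i * \<phi> i x)"
      using False insert.prems by (intro insert.IH) auto
    then obtain c where "\<And>x. f x = (\<Sum>i\<in>I. c i * \<phi> i x)" by blast
    then have "f x = (\<Sum>i\<in>insert j I. (c(j := 0)) i * \<phi> i x)" for x
      using insert.hyps by (auto intro!: sum.cong)
    then show ?thesis by blast
  next
    case True
    then obtain z where z: "\<And>i. i \<in> I \<Longrightarrow> \<phi> i z = 0" "\<phi> j z \<noteq> 0" by blast
    \<comment> \<open>With this choice \<open>f - a * \<phi> j\<close> vanishes at \<open>z\<close>.
      Any \<open>x\<close> in the common kernel over \<open>I\<close> differs by a multiple of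
      \<open>z\<close> from a vector that \<open>\<phi> j\<close> kills as well.\<close>
    define a where "a = f z / \<phi> j z"
    have "\<exists>c. \<forall>x. f x - a * \<phi> j x = (\<Sum>i\<in>I. c i * \<phi> i x)"
    proof (rule insert.IH)
      show "linear (\<lambda>x. f x - a * \<phi> j x)"
        using lin[of j] insert.prems(2)
        by (auto intro!: linearI simp: linear_add linear_scale algebra_simps)
      fix x assume x: "\<And>i. i \<in> I \<Longrightarrow> \<phi> i x = 0"
      have "f (x - (\<phi> j x / \<phi> j z) *\<^sub>R z) = 0"
      proof (rule insert.prems(3))
        fix i assume "i \<in> insert j I"
        then show "\<phi> i (x - (\<phi> j x / \<phi> j z) *\<^sub>R z) = 0"
          using lin[of i] x[of i] z by (auto simp: linear_diff linear_scale)
      qed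
      then show "f x - a * \<phi> j x = 0"
        using insert.prems(2) by (simp add: linear_diff linear_scale a_def)
    qed (use lin in auto)
    then obtain c where "\<And>x. f x - a * \<phi> j x = (\<Sum>i\<in>I. c i * \<phi> i x)" by blast
    then have "f x = a * \<phi> j x + (\<Sum>i\<in>I. c i * \<phi> i x)" for x by (simp add: algebra_simps)
    then have "f x = (\<Sum>i\<in>insert j I. (c(j := a)) i * \<phi> i x)" for x
      using insert.hyps by (auto intro!: sum.cong)
    then show ?thesis by blast
  qed
qed


section \<open>Dual spaces\<close>

lemma linear_co_app: "linear (co_app f)"
  and continuous_co_app: "continuous_on UNIV (co_app f)"
  using co_app[of f] by (auto simp: cont_functionals_def)

lemma linear_weak_app: "linear (weak_app g)"
  and continuous_weak_app: "continuous_on UNIV (weak_app g)"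
  using weak_app[of g] by (auto simp: cont_functionals_def)

lemma co_dual_eqI: "(\<And>x. co_app f x = co_app g x) \<Longrightarrow> f = g"
  by (simp add: co_app_inject[symmetric] fun_eq_iff)

lemma weak_dual_eqI: "(\<And>x. weak_app f x = weak_app g x) \<Longrightarrow> f = g"
  by (simp add: weak_app_inject[symmetric] fun_eq_iff)

lemma co_app_algebra:
  "co_app (f + g) x = co_app f x + co_app g x"
  "co_app (f - g) x = co_app f x - co_app g x"
  "co_app (r *\<^sub>R f) x = r * co_app f x"
  "co_app (- f) x = - co_app f x"
  "co_app 0 x = 0"
  by (transfer; simp)+

lemma weak_app_algebra:
  "weak_app (f + g) x = weak_app f x + weak_app g x"
  "weak_app (r *\<^sub>R f) x = r * weak_app f x"
  by (transfer; simp)+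

lemma co_app_sum: "co_app (\<Sum>i\<in>I. f i) x = (\<Sum>i\<in>I. co_app (f i) x)"
  by (induction I rule: infinite_finite_induct) (simp_all add: co_app_algebra)

text \<open>The weak* topology is pulled back from a product topology, so continuity is a matter of
  coordinates.\<close>

lemma continuous_into_weak_dual:
  fixes h :: "'s::topological_space \<Rightarrow> 'v::{real_vector,topological_space} weak_dual"
  assumes "\<And>f. continuous_on UNIV (\<lambda>s. weak_app (h s) f)"
  shows "continuous_on UNIV h"
  unfolding continuous_on_open_vimage[OF open_UNIV]
proof (intro allI impI)
  fix B :: "'v weak_dual set" assume "open B"
  then obtain W where W: "open W" "B = weak_app -` W" unfolding open_weak_dual_def by blast
  have "continuous_on UNIV (\<lambda>s. weak_app (h s))"
    by (rule continuous_on_coordinatewise_then_product) (rule assms)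
  then have "open ((\<lambda>s. weak_app (h s)) -` W \<inter> UNIV)"
    using W(1) unfolding continuous_on_open_vimage[OF open_UNIV] by blast
  then show "open (h -` B \<inter> UNIV)" using W(2) by (simp add: vimage_def)
qed

lemma continuous_weak_dual_eval: "continuous_on UNIV (\<lambda>g. weak_app g f)"
proof -
  have "continuous_on UNIV (weak_app :: 'a weak_dual \<Rightarrow> 'a \<Rightarrow> real)"
    unfolding continuous_on_open_vimage[OF open_UNIV] open_weak_dual_def by auto
  then show ?thesis by (rule continuous_on_product_then_coordinatewise)
qed

lemma linear_eval_map: "linear eval_map"
  by (rule linearI; rule weak_dual_eqI)
    (simp_all add: weak_app_eval_map weak_app_algebra linear_add linear_scale linear_co_app)

lemma continuous_eval_map: "continuous_on UNIV eval_map"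
  by (rule continuous_into_weak_dual) (simp add: weak_app_eval_map continuous_co_app)

text \<open>Continuity at 0 yields a basic compact-open neighbourhood on which \<open>g\<close>
  stays below 1 in modulus; homogeneity does the rest. A positive bound \<open>m\<close> replaces
  the supremum over \<open>K\<close>, which may be 0 or range over the empty set.\<close>

lemma weak_app_compact_bound:
  fixes g :: "'v::{real_vector,topological_space} co_dual weak_dual"
  obtains K C where "compact K" "C > 0"
    "\<And>f m. m > 0 \<Longrightarrow> (\<And>x. x \<in> K \<Longrightarrow> \<bar>co_app f x\<bar> \<le> m) \<Longrightarrow> \<bar>weak_app g f\<bar> \<le> C * m"
proof -
  have U: "open (weak_app g -` {-1<..<1} \<inter> UNIV)"
    using continuous_weak_app[of g] unfolding continuous_on_open_vimage[OF open_UNIV]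
    using open_greaterThanLessThan by blast
  have zero: "0 \<in> weak_app g -` {-1<..<1} \<inter> UNIV"
    by (simp add: linear_0 linear_weak_app)
  obtain K e where K: "compact K" "e > 0"
    "{f. \<forall>x\<in>K. \<bar>co_app f x - co_app 0 x\<bar> < e} \<subseteq> weak_app g -` {-1<..<1} \<inter> UNIV"
    using bspec[OF U[unfolded open_co_dual_def] zero] by (elim exE conjE)
  show thesis
  proof
    show "compact K" "2 / e > 0" using K by auto
    fix f m assume m: "m > (0::real)" and f: "\<And>x. x \<in> K \<Longrightarrow> \<bar>co_app f x\<bar> \<le> m"
    \<comment> \<open>The half makes \<open>r *\<^sub>R f\<close> strictly smaller than
      \<open>e\<close> on \<open>K\<close>.\<close>
    define r where "r = e / (2 * m)"
    have r: "r > 0" using m K(2) by (simp add: r_def)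
    have "\<bar>co_app (r *\<^sub>R f) x - co_app 0 x\<bar> < e" if "x \<in> K" for x
    proof -
      have "\<bar>co_app (r *\<^sub>R f) x - co_app 0 x\<bar> = r * \<bar>co_app f x\<bar>"
        using r by (simp add: co_app_algebra abs_mult)
      also have "\<dots> \<le> r * m" using f[OF that] r by simp
      also have "\<dots> < e" using m K(2) by (simp add: r_def)
      finally show ?thesis .
    qed
    then have "weak_app g (r *\<^sub>R f) \<in> {-1<..<1}" using K(3) by blast
    then have "\<bar>weak_app g (r *\<^sub>R f)\<bar> < 1" by auto
    then have "r * \<bar>weak_app g f\<bar> < 1"
      using r by (simp add: linear_scale linear_weak_app abs_mult)
    then have "\<bar>weak_app g f\<bar> < 1 / r" using r by (simp add: field_simps)
    then show "\<bar>weak_app g f\<bar> \<le> 2 / e * m" using m K(2) by (simp add: r_def)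
  qed
qed

section \<open>Dual and predual maps\<close>

lemma linear_co_dual_map:
  assumes "linear h" "continuous_on UNIV h"
  shows "linear (co_dual_map h)"
  by (rule linearI; rule co_dual_eqI) (simp_all add: co_app_co_dual_map[OF assms] co_app_algebra)

lemma continuous_co_dual_map:
  fixes h :: "'w::{real_vector,topological_space} \<Rightarrow> 'v::{real_vector,topological_space}"
  assumes "linear h" "continuous_on UNIV h"
  shows "continuous_on UNIV (co_dual_map h)"
  unfolding continuous_on_open_vimage[OF open_UNIV]
proof (intro allI impI)
  fix B :: "'w co_dual set" assume B: "open B"
  show "open (co_dual_map h -` B \<inter> UNIV)"
    unfolding open_co_dual_def
  proof
    fix f assume "f \<in> co_dual_map h -` B \<inter> UNIV"
    then obtain K e where K: "compact K" "e > 0"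
      "{g. \<forall>x\<in>K. \<bar>co_app g x - co_app (co_dual_map h f) x\<bar> < e} \<subseteq> B"
      using bspec[OF B[unfolded open_co_dual_def], of "co_dual_map h f"] by auto
    have "compact (h ` K)"
      using K(1) assms(2) by (meson compact_continuous_image continuous_on_subset subset_UNIV)
    moreover have "{g. \<forall>x\<in>h ` K. \<bar>co_app g x - co_app f x\<bar> < e} \<subseteq> co_dual_map h -` B \<inter> UNIV"
      using K(3) by (auto simp: co_app_co_dual_map[OF assms] subset_iff)
    ultimately show "\<exists>K e. compact K \<and> 0 < e \<and>
        {g. \<forall>x\<in>K. \<bar>co_app g x - co_app f x\<bar> < e} \<subseteq> co_dual_map h -` B \<inter> UNIV"
      using K(2) by blast
  qed
qed

lemma continuous_weak_dual_map:
  assumes "linear h" "continuous_on UNIV h"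
  shows "continuous_on UNIV (weak_dual_map h)"
  by (rule continuous_into_weak_dual)
    (simp add: weak_app_weak_dual_map[OF assms] continuous_weak_dual_eval)

lemma co_dual_map_cont_pos_linear:
  assumes "h \<in> cont_pos_linear D C"
  shows "co_dual_map h \<in> cont_pos_linear (co_dual_cone C) (co_dual_cone D)"
proof -
  have h: "linear h" "continuous_on UNIV h" "h ` D \<subseteq> C"
    using assms by (auto simp: cont_pos_linear_def)
  then show ?thesis
    using linear_co_dual_map[OF h(1,2)] continuous_co_dual_map[OF h(1,2)]
    by (auto simp: cont_pos_linear_def co_dual_cone_def co_app_co_dual_map)
qed

text \<open>The continuous inverse is identified with \<open>inv h\<close>, the form that occurs in
  \<open>predual_map\<close>.\<close>

lemma ordered_tvs_isoD:
  assumes "ordered_tvs_iso C D h"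
  shows "bij h" "continuous_on UNIV (inv h)" "h ` C = D"
proof -
  obtain k where k: "homeomorphism UNIV UNIV h k"
    using assms by (auto simp: ordered_tvs_iso_def)
  then have hk: "h (k y) = y" and kh: "k (h x) = x" for x y
    by (auto simp: homeomorphism_def)
  show "bij h" using hk kh by (intro o_bij[of k]) auto
  have "inv h = k" using hk kh by (intro inv_equality) auto
  then show "continuous_on UNIV (inv h)" using k by (simp add: homeomorphism_def)
  show "h ` C = D" using assms by (simp add: ordered_tvs_iso_def)
qed

text \<open>The duality formula from which the other properties of \<open>predual_map\<close> are
  derived. Surjectivity of \<open>eval_map\<close> makes \<open>inv eval_map\<close> a right
  inverse.\<close>

lemma co_app_predual_map:
  fixes C :: "'v::{real_vector,topological_space} set"
    and D :: "'w::{real_vector,topological_space} set"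
  assumes iso: "ordered_tvs_iso C (weak_dual_cone (co_dual_cone C)) eval_map"
    and h: "h \<in> cont_pos_linear (co_dual_cone C) (co_dual_cone D)"
  shows "co_app f (predual_map h x) = co_app (h f) x"
proof -
  have "eval_map (predual_map h x) = weak_dual_map h (eval_map x)"
    using ordered_tvs_isoD(1)[OF iso]
    by (simp add: predual_map_def surj_f_inv_f bij_is_surj)
  then have "weak_app (eval_map (predual_map h x)) f = weak_app (weak_dual_map h (eval_map x)) f"
    by simp
  then show ?thesis
    using h by (simp add: weak_app_eval_map weak_app_weak_dual_map cont_pos_linear_def)
qed

text \<open>Injectivity of \<open>eval_map\<close> means that functionals separate points.\<close>

lemma eq_if_co_app_eq:
  fixes x y :: "'v::{real_vector,topological_space}" and C :: "'v set"
  assumes "ordered_tvs_iso C (weak_dual_cone (co_dual_cone C)) eval_map"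
    and "\<And>f. co_app f x = co_app f y"
  shows "x = y"
proof -
  have "eval_map x = eval_map y"
    by (rule weak_dual_eqI) (simp add: weak_app_eval_map assms(2))
  then show ?thesis using ordered_tvs_isoD(1)[OF assms(1)] by (simp add: bij_def inj_def)
qed

text \<open>A bipolar statement for \<open>C\<close>: the assumption puts \<open>eval_map x\<close>
  into the bidual cone, which is the image of \<open>C\<close>.\<close>

lemma in_cone_if_co_app_nonneg:
  fixes x :: "'v::{real_vector,topological_space}" and C :: "'v set"
  assumes iso: "ordered_tvs_iso C (weak_dual_cone (co_dual_cone C)) eval_map"
    and "\<And>f. f \<in> co_dual_cone C \<Longrightarrow> co_app f x \<ge> 0"
  shows "x \<in> C"
proof -
  have "eval_map x \<in> eval_map ` C"
    unfolding ordered_tvs_isoD(3)[OF iso]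
    using assms(2) by (simp add: weak_dual_cone_def weak_app_eval_map)
  then show ?thesis using ordered_tvs_isoD(1)[OF iso] by (simp add: bij_def inj_image_mem_iff)
qed

text \<open>Linearity and positivity are tested against functionals by the duality formula;
  continuity comes from that of the three factors, \<open>inv eval_map\<close> included.\<close>

lemma predual_map_cont_pos_linear:
  fixes C :: "'v::{real_vector,topological_space} set"
    and D :: "'w::{real_vector,topological_space} set"
  assumes iso: "ordered_tvs_iso C (weak_dual_cone (co_dual_cone C)) eval_map"
    and h: "h \<in> cont_pos_linear (co_dual_cone C) (co_dual_cone D)"
  shows "predual_map h \<in> cont_pos_linear D C"
  unfolding cont_pos_linear_def
proof (intro CollectI conjI)
  note app = co_app_predual_map[OF iso h]
  have hl: "linear h" "continuous_on UNIV h" "h ` co_dual_cone C \<subseteq> co_dual_cone D"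
    using h by (auto simp: cont_pos_linear_def)
  show "linear (predual_map h)"
    by (rule linearI; rule eq_if_co_app_eq[OF iso])
      (simp_all add: app linear_add linear_scale linear_co_app)
  have "continuous_on UNIV (weak_dual_map h \<circ> eval_map)"
    by (intro continuous_on_compose continuous_eval_map
        continuous_on_subset[OF continuous_weak_dual_map[OF hl(1,2)]]) simp
  then have "continuous_on UNIV (inv eval_map \<circ> (weak_dual_map h \<circ> eval_map))"
    by (rule continuous_on_compose[OF _ continuous_on_subset[OF ordered_tvs_isoD(2)[OF iso]]]) simp
  then show "continuous_on UNIV (predual_map h)"
    by (simp add: predual_map_def o_assoc)
  show "predual_map h ` D \<subseteq> C"
  proof (rule image_subsetI, rule in_cone_if_co_app_nonneg[OF iso])
    fix x f assume "x \<in> D" "f \<in> co_dual_cone C"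
    then show "co_app f (predual_map h x) \<ge> 0"
      using hl(3) by (auto simp: app co_dual_cone_def)
  qed
qed

lemma co_dual_map_predual_map:
  fixes C :: "'v::{real_vector,topological_space} set"
    and D :: "'w::{real_vector,topological_space} set"
  assumes iso: "ordered_tvs_iso C (weak_dual_cone (co_dual_cone C)) eval_map"
    and h: "h \<in> cont_pos_linear (co_dual_cone C) (co_dual_cone D)"
  shows "co_dual_map (predual_map h) = h"
proof -
  have "linear (predual_map h)" "continuous_on UNIV (predual_map h)"
    using predual_map_cont_pos_linear[OF iso h] by (auto simp: cont_pos_linear_def)
  then show ?thesis
    by (intro ext co_dual_eqI) (simp add: co_app_co_dual_map co_app_predual_map[OF iso h])
qed

lemma predual_map_co_dual_map:
  fixes C :: "'v::{real_vector,topological_space} set"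
    and D :: "'w::{real_vector,topological_space} set"
  assumes iso: "ordered_tvs_iso C (weak_dual_cone (co_dual_cone C)) eval_map"
    and h: "h \<in> cont_pos_linear D C"
  shows "predual_map (co_dual_map h) = h"
proof
  fix x
  have "linear h" "continuous_on UNIV h" using h by (auto simp: cont_pos_linear_def)
  then show "predual_map (co_dual_map h) x = h x"
    by (intro eq_if_co_app_eq[OF iso])
      (simp add: co_app_predual_map[OF iso co_dual_map_cont_pos_linear[OF h]] co_app_co_dual_map)
qed


section \<open>Point evaluations on the trace space\<close>

lemma trace_app_outside: "x \<notin> ped \<Longrightarrow> trace_app t x = 0"
  and ped_linear_trace_app: "ped_linear (trace_app t)"
  and continuous_trace_app: "continuous_map ped_topology euclidean (trace_app t)"
  and trace_app_commute: "x \<in> ped \<Longrightarrow> y \<in> ped \<Longrightarrow> trace_app t (x * y) = trace_app t (y * x)"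
  and trace_app_star: "x \<in> ped \<Longrightarrow> trace_app t (star x) = cnj (trace_app t x)"
  using trace_app[of t] by auto

lemma trace_app_add: "x \<in> ped \<Longrightarrow> y \<in> ped \<Longrightarrow> trace_app t (x + y) = trace_app t x + trace_app t y"
  and trace_app_scaleC: "x \<in> ped \<Longrightarrow> trace_app t (scaleC c x) = c * trace_app t x"
  using ped_linear_trace_app[of t] by (auto simp: ped_linear_def)

lemma trace_app_algebra:
  "trace_app (s + t) x = trace_app s x + trace_app t x"
  "trace_app (r *\<^sub>R t) x = r *\<^sub>R trace_app t x"
  "trace_app 0 x = 0"
  by (transfer; simp)+

lemma trace_eqI: "(\<And>x. trace_app s x = trace_app t x) \<Longrightarrow> s = t"
  by (simp add: trace_app_inject[symmetric] fun_eq_iff)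

lemma continuous_into_trace_space:
  fixes h :: "'s::topological_space \<Rightarrow> 'a::cstar_algebra trace_space"
  assumes "\<And>x. continuous_on UNIV (\<lambda>s. trace_app (h s) x)"
  shows "continuous_on UNIV h"
  unfolding continuous_on_open_vimage[OF open_UNIV]
proof (intro allI impI)
  fix B :: "'a trace_space set" assume "open B"
  then obtain W where W: "open W" "B = trace_app -` W" unfolding open_trace_space_def by blast
  have "continuous_on UNIV (\<lambda>s. trace_app (h s))"
    by (rule continuous_on_coordinatewise_then_product) (rule assms)
  then have "open ((\<lambda>s. trace_app (h s)) -` W \<inter> UNIV)"
    using W(1) unfolding continuous_on_open_vimage[OF open_UNIV] by blast
  then show "open (h -` B \<inter> UNIV)" using W(2) by (simp add: vimage_def)
qed

lemma continuous_trace_eval: "continuous_on S (\<lambda>t. trace_app t x)"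
proof -
  have "continuous_on UNIV (trace_app :: 'a trace_space \<Rightarrow> 'a \<Rightarrow> complex)"
    unfolding continuous_on_open_vimage[OF open_UNIV] open_trace_space_def by auto
  then have "continuous_on UNIV (\<lambda>t. trace_app t x)"
    by (rule continuous_on_product_then_coordinatewise)
  then show ?thesis by (rule continuous_on_subset) simp
qed

text \<open>The real part of a point evaluation is \<open>trace_eval 1 x\<close>, its imaginary part
  \<open>trace_eval (- \<i>) x\<close>.\<close>

definition trace_eval :: "complex \<Rightarrow> 'a::cstar_algebra \<Rightarrow> 'a trace_space co_dual" where
  "trace_eval c x = Abs_co_dual (\<lambda>t. Re (c * trace_app t x))"

lemma co_app_trace_eval: "co_app (trace_eval c x) t = Re (c * trace_app t x)"
proof -
  have "(\<lambda>t. Re (c * trace_app t x)) \<in> cont_functionals"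
    unfolding cont_functionals_def
    by (auto intro!: linearI continuous_intros continuous_trace_eval
        simp: trace_app_algebra algebra_simps)
  then show ?thesis by (simp add: trace_eval_def Abs_co_dual_inverse)
qed

lemma trace_eval_outside: "x \<notin> ped \<Longrightarrow> trace_eval c x = 0"
  by (rule co_dual_eqI) (simp add: co_app_trace_eval trace_app_outside co_app_algebra)

lemma trace_eval_add:
  "x \<in> ped \<Longrightarrow> y \<in> ped \<Longrightarrow> trace_eval c (x + y) = trace_eval c x + trace_eval c y"
  by (rule co_dual_eqI) (simp add: co_app_trace_eval trace_app_add co_app_algebra algebra_simps)

text \<open>The purpose of the index \<open>c\<close>: it absorbs complex scalars, although the dual
  is only a real vector space.\<close>

lemma trace_eval_scaleC: "x \<in> ped \<Longrightarrow> trace_eval c (scaleC d x) = trace_eval (c * d) x"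
  by (rule co_dual_eqI) (simp add: co_app_trace_eval trace_app_scaleC mult.assoc)

lemma trace_eval_commute:
  "x \<in> ped \<Longrightarrow> y \<in> ped \<Longrightarrow> trace_eval c (x * y) = trace_eval c (y * x)"
  by (rule co_dual_eqI) (simp add: co_app_trace_eval trace_app_commute)

lemma trace_eval_star: "x \<in> ped \<Longrightarrow> trace_eval c (star x) = trace_eval (cnj c) x"
  by (rule co_dual_eqI) (simp add: co_app_trace_eval trace_app_star)

text \<open>Real and imaginary part determine all evaluations at \<open>x\<close>, since
  \<open>Re (c * z) = Re c * Re z - Im c * Im z\<close>.\<close>

lemma trace_eval_decompose:
  "trace_eval c x = Re c *\<^sub>R trace_eval 1 x - Im c *\<^sub>R trace_eval (- \<i>) x"
  by (rule co_dual_eqI) (simp add: co_app_trace_eval co_app_algebra)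

text \<open>A weak*-continuous functional is bounded on the common kernel of finitely many point
  evaluations, hence vanishes there.\<close>

lemma co_dual_trace_space_combination:
  fixes f :: "'a::cstar_algebra trace_space co_dual"
  obtains I a where "f = (\<Sum>(c, x)\<in>I. a (c, x) *\<^sub>R trace_eval c x)"
proof -
  have "open (co_app f -` {-1<..<1} \<inter> UNIV)"
    using continuous_co_app[of f] unfolding continuous_on_open_vimage[OF open_UNIV]
    using open_greaterThanLessThan by blast
  then obtain W where W: "open W" "co_app f -` {-1<..<1} = trace_app -` W"
    unfolding open_trace_space_def by auto
  have "0 \<in> co_app f -` {-1<..<1}" by (simp add: linear_0 linear_co_app)
  then have "trace_app 0 \<in> W" using W(2) by auto
  \<comment> \<open>A basic open box around 0 inside \<open>W\<close>; only the finitely many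
    coordinates in \<open>F\<close> below are restricted.\<close>
  then obtain X where X: "trace_app 0 \<in> (\<Pi>\<^sub>E i\<in>UNIV. X i)" "finite {i. X i \<noteq> UNIV}"
    "(\<Pi>\<^sub>E i\<in>UNIV. X i) \<subseteq> W"
    using product_topology_open_contains_basis[of "\<lambda>_. euclidean" UNIV W "trace_app 0"] W(1)
    unfolding open_fun_def by auto
  define F where "F = {i. X i \<noteq> UNIV}"
  define I where "I = {1, - \<i>} \<times> F"
  have vanish: "co_app f t = 0" if t: "\<And>x. x \<in> F \<Longrightarrow> trace_app t x = 0" for t
  proof (rule ccontr)
    assume nz: "co_app f t \<noteq> 0"
    \<comment> \<open>All multiples of \<open>t\<close> lie in the box, also this one, where
      \<open>f\<close> takes the excluded value 1.\<close>
    define r where "r = 1 / co_app f t"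
    have "trace_app (r *\<^sub>R t) x \<in> X x" for x
      using t[of x] X(1) by (cases "x \<in> F") (auto simp: F_def trace_app_algebra PiE_iff)
    then have "trace_app (r *\<^sub>R t) \<in> W" using X(3) by (auto simp: PiE_iff)
    then have "r *\<^sub>R t \<in> co_app f -` {-1<..<1}" using W(2) by blast
    then show False using nz by (simp add: linear_scale linear_co_app r_def)
  qed
  have fin: "finite I" using X(2) by (simp add: I_def F_def)
  have "\<exists>a. \<forall>t. co_app f t = (\<Sum>p\<in>I. a p * co_app (trace_eval (fst p) (snd p)) t)"
  proof (rule linear_functional_combination[OF fin])
    fix t assume t: "\<And>p. p \<in> I \<Longrightarrow> co_app (trace_eval (fst p) (snd p)) t = 0"
    have "trace_app t x = 0" if "x \<in> F" for x
      using t[of "(1, x)"] t[of "(- \<i>, x)"] that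
      by (simp add: I_def co_app_trace_eval complex_eq_iff)
    then show "co_app f t = 0" by (rule vanish)
  qed (simp_all add: linear_co_app)
  then obtain a where a: "\<And>t. co_app f t = (\<Sum>p\<in>I. a p * co_app (trace_eval (fst p) (snd p)) t)"
    by blast
  have "f = (\<Sum>(c, x)\<in>I. a (c, x) *\<^sub>R trace_eval c x)"
    by (rule co_dual_eqI) (simp add: a co_app_sum co_app_algebra case_prod_unfold)
  then show thesis by (rule that)
qed


section \<open>The trace of a functional on the dual\<close>

text \<open>As \<open>g\<close> is real-valued, the complex value is assembled from its values at
  the real and the imaginary part of the point evaluation.\<close>

definition functional_trace_fun ::
  "'a::cstar_algebra trace_space co_dual weak_dual \<Rightarrow> 'a \<Rightarrow> complex" where
  "functional_trace_fun g x =
     Complex (weak_app g (trace_eval 1 x)) (weak_app g (trace_eval (- \<i>) x))"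

lemma weak_app_trace_eval: "weak_app g (trace_eval c x) = Re (c * functional_trace_fun g x)"
  by (subst trace_eval_decompose)
    (simp add: functional_trace_fun_def linear_diff linear_scale linear_weak_app)

text \<open>A complex number \<open>z\<close> is determined by the numbers
  \<open>Re (c * z)\<close>. Identities for the trace thereby reduce to identities between point
  evaluations.\<close>

lemma functional_trace_fun_eqI:
  assumes "\<And>c. weak_app g (trace_eval c x) = Re (c * z)"
  shows "functional_trace_fun g x = z"
  using assms[of 1] assms[of "- \<i>"] by (simp add: functional_trace_fun_def complex_eq_iff)

lemma ped_linear_functional_trace_fun: "ped_linear (functional_trace_fun g)"
  unfolding ped_linear_def
  by (auto intro!: functional_trace_fun_eqI
      simp: trace_eval_add trace_eval_scaleC linear_add[OF linear_weak_app] weak_app_trace_eval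
        algebra_simps)

text \<open>Compact sets of traces are pointwise bounded, hence by Banach-Steinhaus uniformly bounded
  on the unit ball of each \<open>D\<close>.\<close>

lemma continuous_on_functional_trace_fun:
  fixes g :: "'a::cstar_algebra trace_space co_dual weak_dual"
  assumes D: "cstar_subalgebra D" "D \<subseteq> ped"
  shows "continuous_on D (functional_trace_fun g)"
proof -
  obtain K C where K: "compact K" "C > 0"
    and bound: "\<And>f m. m > 0 \<Longrightarrow> (\<And>t. t \<in> K \<Longrightarrow> \<bar>co_app f t\<bar> \<le> m) \<Longrightarrow> \<bar>weak_app g f\<bar> \<le> C * m"
    using weak_app_compact_bound by metis
  have csub: "0 \<in> D" "\<And>x y. x \<in> D \<Longrightarrow> y \<in> D \<Longrightarrow> x + y \<in> D" "\<And>c x. x \<in> D \<Longrightarrow> scaleC c x \<in> D"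
    using D(1) by (auto simp: cstar_subalgebra_def csubspace_def)
  have sub: "subspace D"
    using csub by (auto simp: subspace_def simp flip: scaleC_of_real)
  have diff: "t (x - y) = t x - t y" if "ped_linear t" "x \<in> D" "y \<in> D"
    for t :: "'a \<Rightarrow> complex" and x y
  proof -
    have "x - y \<in> D" using sub that by (simp add: subspace_diff)
    then have "t (x - y + y) = t (x - y) + t y" using that D(2) unfolding ped_linear_def by blast
    then show ?thesis by simp
  qed
  obtain M where M: "M > 0" "\<And>t x. t \<in> K \<Longrightarrow> x \<in> D \<Longrightarrow> cmod (trace_app t x) \<le> M * norm x"
  proof (rule uniform_boundedness_closed_subspace[of D K trace_app])
    show "closed D" using D(1) by (simp add: cstar_subalgebra_def)
    show "subspace D" by (rule sub)
    show "continuous_on D (trace_app t)" for t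
      using continuous_map_ped_topology_iff[OF ped_linear_trace_app] continuous_trace_app D by blast
    show "trace_app t (x - y) = trace_app t x - trace_app t y" if "x \<in> D" "y \<in> D" for t x y
      using diff[OF ped_linear_trace_app that] .
    show "trace_app t (r *\<^sub>R x) = r *\<^sub>R trace_app t x" if "x \<in> D" for t r x
      using that D(2) trace_app_scaleC[of x t "complex_of_real r"]
      by (auto simp: scaleC_of_real scaleR_conv_of_real)
    \<comment> \<open>Evaluation at \<open>x\<close> is weak*-continuous, so the compact set
      \<open>K\<close> has bounded image.\<close>
    show "\<exists>B. \<forall>t\<in>K. cmod (trace_app t x) \<le> B" for x
      using compact_imp_bounded[OF compact_continuous_image[OF continuous_trace_eval K(1)]]
      by (auto simp: bounded_iff)
  qed blast
  have fun_bound: "cmod (functional_trace_fun g x) \<le> 2 * C * M * norm x" if x: "x \<in> D" for x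
  \<comment> \<open>\<open>bound\<close> is applied with \<open>m = M * norm x\<close>, which must
    be positive.\<close>
  proof (cases "x = 0")
    case True
    then show ?thesis
      using diff[OF ped_linear_functional_trace_fun csub(1) csub(1), of g] by simp
  next
    case False
    have part: "\<bar>weak_app g (trace_eval c x)\<bar> \<le> C * (M * norm x)" if "cmod c = 1" for c
    proof (rule bound)
      show "M * norm x > 0" using False M(1) by simp
      fix t assume "t \<in> K"
      have "\<bar>Re (c * trace_app t x)\<bar> \<le> cmod (c * trace_app t x)" by (rule abs_Re_le_cmod)
      also have "\<dots> \<le> M * norm x" using M(2)[OF \<open>t \<in> K\<close> x] that by (simp add: norm_mult)
      finally show "\<bar>co_app (trace_eval c x) t\<bar> \<le> M * norm x" by (simp add: co_app_trace_eval)
    qed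
    show ?thesis
      using part[of 1] part[of "- \<i>"] cmod_le[of "functional_trace_fun g x"]
      by (simp add: functional_trace_fun_def)
  qed
  show ?thesis
  proof (rule lipschitz_on_continuous_on, rule lipschitz_onI)
    show "0 \<le> 2 * C * M" using K(2) M(1) by simp
    fix x y assume xy: "x \<in> D" "y \<in> D"
    then have "x - y \<in> D" using sub by (simp add: subspace_diff)
    then show "dist (functional_trace_fun g x) (functional_trace_fun g y) \<le> 2 * C * M * dist x y"
      using fun_bound[of "x - y"] diff[OF ped_linear_functional_trace_fun xy, of g]
      by (simp add: dist_norm)
  qed
qed

section \<open>The inverse of the canonical map\<close>

definition functional_trace ::
  "'a::cstar_algebra trace_space co_dual weak_dual \<Rightarrow> 'a trace_space" where
  "functional_trace g = Abs_trace (functional_trace_fun g)"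

text \<open>The algebraic conditions on a trace are inherited from the point evaluations; continuity
  is checked on each \<open>D\<close>.\<close>

lemma trace_app_functional_trace: "trace_app (functional_trace g) = functional_trace_fun g"
  unfolding functional_trace_def
proof (rule Abs_trace_inverse, intro CollectI conjI allI ballI impI)
  show "functional_trace_fun g x = 0" if "x \<notin> ped" for x
    using that by (intro functional_trace_fun_eqI)
      (simp add: trace_eval_outside linear_0 linear_weak_app)
  show "ped_linear (functional_trace_fun g)" by (rule ped_linear_functional_trace_fun)
  then show "continuous_map ped_topology euclidean (functional_trace_fun g)"
    using continuous_map_ped_topology_iff continuous_on_functional_trace_fun by blast
  show "functional_trace_fun g (x * y) = functional_trace_fun g (y * x)"
    if "x \<in> ped" "y \<in> ped" for x y
    using that by (simp add: functional_trace_fun_def trace_eval_commute)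
  show "functional_trace_fun g (star x) = cnj (functional_trace_fun g x)" if "x \<in> ped" for x
    using that by (intro functional_trace_fun_eqI) (simp add: trace_eval_star weak_app_trace_eval)
qed

lemma functional_trace_eval_map: "functional_trace (eval_map t) = t"
  by (rule trace_eqI, unfold trace_app_functional_trace, rule functional_trace_fun_eqI)
    (simp add: weak_app_eval_map co_app_trace_eval)

text \<open>Both sides agree on point evaluations by construction, and these span the dual of the
  trace space.\<close>

lemma eval_map_functional_trace:
  fixes g :: "'a::cstar_algebra trace_space co_dual weak_dual"
  shows "eval_map (functional_trace g) = g"
proof (rule weak_dual_eqI)
  fix f :: "'a trace_space co_dual"
  obtain I a where f: "f = (\<Sum>(c, x)\<in>I. a (c, x) *\<^sub>R trace_eval c x)"
    by (rule co_dual_trace_space_combination)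
  have "weak_app (eval_map (functional_trace g)) (trace_eval c x) = weak_app g (trace_eval c x)"
    for c x
    by (subst weak_app_eval_map)
      (simp add: co_app_trace_eval trace_app_functional_trace weak_app_trace_eval)
  then show "weak_app (eval_map (functional_trace g)) f = weak_app g f"
    by (simp add: f linear_sum[OF linear_weak_app] linear_scale[OF linear_weak_app]
        case_prod_unfold)
qed

lemma continuous_functional_trace: "continuous_on UNIV functional_trace"
proof (rule continuous_into_trace_space)
  fix x :: 'a
  show "continuous_on UNIV (\<lambda>g. trace_app (functional_trace g) x)"
    unfolding trace_app_functional_trace functional_trace_fun_def Complex_eq
    by (intro continuous_intros continuous_weak_dual_eval)
qed

lemma cstar_pos_star: "a \<in> cstar_pos \<Longrightarrow> star a = a"
  by (auto simp: cstar_pos_def star_mult star_star)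

text \<open>The inverse is \<open>functional_trace\<close>. It respects the cones because evaluation
  at a positive \<open>a\<close> in \<open>ped\<close> belongs to
  \<open>co_dual_cone pos_traces\<close>, so a positive \<open>g\<close> is nonnegative on
  it.\<close>

lemma ordered_tvs_iso_eval_map:
  "ordered_tvs_iso (pos_traces :: 'a::cstar_algebra trace_space set)
     (weak_dual_cone (co_dual_cone pos_traces)) eval_map"
proof -
  have "homeomorphism UNIV UNIV (eval_map :: 'a trace_space \<Rightarrow> _) functional_trace"
    by (intro homeomorphismI)
      (auto simp: continuous_eval_map continuous_functional_trace functional_trace_eval_map
        eval_map_functional_trace)
  moreover have "functional_trace g \<in> (pos_traces :: 'a trace_space set)"
    if g: "g \<in> weak_dual_cone (co_dual_cone pos_traces)" for g
    unfolding pos_traces_def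
  proof (intro CollectI ballI conjI)
    fix a :: 'a assume a: "a \<in> ped \<inter> cstar_pos"
    \<comment> \<open>Positive elements are self-adjoint, so a self-adjoint functional is real on
      them.\<close>
    then have "trace_app (functional_trace g) a = cnj (trace_app (functional_trace g) a)"
      using trace_app_star[of a "functional_trace g"] cstar_pos_star[of a] by auto
    then show "trace_app (functional_trace g) a \<in> \<real>" by (simp add: Reals_cnj_iff)
    have "trace_eval 1 a \<in> co_dual_cone pos_traces"
      using a by (simp add: co_dual_cone_def co_app_trace_eval pos_traces_def)
    then have "weak_app g (trace_eval 1 a) \<ge> 0" using g by (auto simp: weak_dual_cone_def)
    then show "Re (trace_app (functional_trace g) a) \<ge> 0"
      by (simp add: trace_app_functional_trace functional_trace_fun_def)
  qed
  then have
    "weak_dual_cone (co_dual_cone (pos_traces :: 'a trace_space set)) \<subseteq> eval_map ` pos_traces"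
    by (metis eval_map_functional_trace image_eqI subsetI)
  then have "eval_map ` pos_traces = weak_dual_cone (co_dual_cone (pos_traces :: 'a trace_space set))"
    by (auto simp: weak_dual_cone_def co_dual_cone_def weak_app_eval_map)
  ultimately show ?thesis
    unfolding ordered_tvs_iso_def using linear_eval_map by blast
qed

theorem theorem4:
  shows
    "ordered_tvs_iso (pos_traces :: 'a::cstar_algebra trace_space set)
       (weak_dual_cone (co_dual_cone pos_traces)) eval_map \<and>
     bij_betw co_dual_map
       (cont_pos_linear (pos_traces :: 'b::cstar_algebra trace_space set)
                        (pos_traces :: 'a trace_space set))
       (cont_pos_linear (co_dual_cone pos_traces) (co_dual_cone pos_traces)) \<and>
     bij_betw predual_map
       (cont_pos_linear (co_dual_cone (pos_traces :: 'a trace_space set))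
                        (co_dual_cone (pos_traces :: 'b trace_space set)))
       (cont_pos_linear pos_traces pos_traces) \<and>
     (\<forall>\<gamma> \<in> cont_pos_linear (pos_traces :: 'b trace_space set) (pos_traces :: 'a trace_space set).
        predual_map (co_dual_map \<gamma>) = \<gamma>) \<and>
     (\<forall>\<eta> \<in> cont_pos_linear (co_dual_cone (pos_traces :: 'a trace_space set))
                            (co_dual_cone (pos_traces :: 'b trace_space set)).
        co_dual_map (predual_map \<eta>) = \<eta> \<and>
        (\<forall>f \<tau>. co_app f (predual_map \<eta> \<tau>) = co_app (\<eta> f) \<tau>))"
proof (intro conjI ballI allI)
  \<comment> \<open>\<open>predual_map\<close> takes values in the traces of \<open>'a\<close>, so
    this is the space on which \<open>eval_map\<close> is inverted.\<close>
  note iso = ordered_tvs_iso_eval_map[where 'a='a]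
  note inverse = predual_map_co_dual_map[OF iso] co_dual_map_predual_map[OF iso]
  note maps = co_dual_map_cont_pos_linear predual_map_cont_pos_linear[OF iso]
  show "bij_betw co_dual_map
      (cont_pos_linear (pos_traces :: 'b trace_space set) (pos_traces :: 'a trace_space set))
      (cont_pos_linear (co_dual_cone pos_traces) (co_dual_cone pos_traces))"
    by (rule bij_betw_byWitness[where f' = predual_map]) (auto simp: inverse maps)
  show "bij_betw predual_map
      (cont_pos_linear (co_dual_cone (pos_traces :: 'a trace_space set))
        (co_dual_cone (pos_traces :: 'b trace_space set)))
      (cont_pos_linear pos_traces pos_traces)"
    by (rule bij_betw_byWitness[where f' = co_dual_map]) (auto simp: inverse maps)
qed (simp_all add: ordered_tvs_iso_eval_map predual_map_co_dual_map[OF ordered_tvs_iso_eval_map]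
    co_dual_map_predual_map[OF ordered_tvs_iso_eval_map]
    co_app_predual_map[OF ordered_tvs_iso_eval_map])

end
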